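(* For any positive integers $m\ge n$ we have $$\varsigma(\mathcal{P}_{n,m})=\sum_{i=1}^{n}\binom{m}{i}\sum_{k=1}^{\min\{i,\,m-i\}}\binom{i}{k}\left[-\frac12\binom{m-i}{k}+\sum_{j=k}^{\min\{n+k-i,\,m-i\}}\frac{k}{j+1}\binom{m-i}{j}\right].$$
   Context: Let $\mathbb{K}$ be an algebraically closed field of characteristic zero. A semistandard Young tableau of partition shape $\lambda$ is a filling of the Ferrers diagram of $\lambda$ (English notation) with positive integers, strictly increasing down columns and weakly increasing from left to right along rows. For positive integers $m\ge n$, $\mathrm{SSYT}_m^n$ denotes the set of all semistandard Young tableaux of all partition shapes with at most $n$ rows and with entries in $\{1,\dots,m\}$. For $T$ of shape $\lambda$ and $T'$ of shape $\mu$, $T\star T'$ is the semistandard Young tableau of shape $\lambda+\mu$ obtained by horizontally concatenating the rows of $T$ and $T'$ and sorting the entries in each row in weakly increasing order. Let $G_{n,m}$ be the set of tableaux in $\mathrm{SSYT}_m^n$ with exactly one column (of height $1,\dots,n$), and $\mathbb{K}[G_{n,m}]$ the polynomial ring in commuting variables indexed by $G_{n,m}$. $\mathcal{P}_{n,m}$ is the ideal of $\mathbb{K}[G_{n,m}]$ generated by all $T_1T_2-T_3T_4$ with $T_1,T_2,T_3,T_4\in G_{n,m}$ distinct and $T_1\star T_2=T_3\star T_4$. $\varsigma(\mathcal{P}_{n,m})$ denotes the cardinality of a minimal generating set for the ideal $\mathcal{P}_{n,m}$, i.e. the minimal number of generators. *)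

theory Defs
  imports
    "HOL-Algebra.Ideal"
    "HOL-Library.Poly_Mapping"
    "HOL-Computational_Algebra.Polynomial"
begin

(* English notation: the list of the nonempty rows, from top to bottom. *)
type_synonym tableau = "nat list list"

definition shape :: "tableau \<Rightarrow> nat list" where
  "shape T = map length T"

definition is_partition :: "nat list \<Rightarrow> bool" where
  "is_partition l \<longleftrightarrow> sorted_wrt (\<ge>) l \<and> (\<forall>a\<in>set l. 0 < a)"

(* For adjacent rows of a partition shape, row i + 1 is not longer than row i,
   so T ! i ! j below is always a cell. *)
definition semistandard :: "tableau \<Rightarrow> bool" where
  "semistandard T \<longleftrightarrow>
     is_partition (shape T) \<and>
     (\<forall>r\<in>set T. sorted r \<and> (\<forall>a\<in>set r. 0 < a)) \<and>
     (\<forall>i j. Suc i < length T \<and> j < length (T ! Suc i) \<longrightarrow> T ! i ! j < T ! Suc i ! j)"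

definition SSYT :: "nat \<Rightarrow> nat \<Rightarrow> tableau set" where
  "SSYT n m = {T. semistandard T \<and> length T \<le> n \<and> (\<forall>r\<in>set T. set r \<subseteq> {1..m})}"

definition row :: "tableau \<Rightarrow> nat \<Rightarrow> nat list" where
  "row T i = (if i < length T then T ! i else [])"

definition star :: "tableau \<Rightarrow> tableau \<Rightarrow> tableau" (infixl "\<star>" 70) where
  "T \<star> T' = map (\<lambda>i. sort (row T i @ row T' i)) [0..<max (length T) (length T')]"

(* The number of columns of a partition shape is its first part. *)
definition num_columns :: "tableau \<Rightarrow> nat" where
  "num_columns T = length (row T 0)"

definition G :: "nat \<Rightarrow> nat \<Rightarrow> tableau set" where
  "G n m = {T \<in> SSYT n m. num_columns T = 1}"

(* A polynomial is a finitely supported map from exponent vectors to coefficients;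
   the multiplication of Poly_Mapping is convolution. *)
type_synonym ('x, 'k) mpolynomial = "('x \<Rightarrow>\<^sub>0 nat) \<Rightarrow>\<^sub>0 'k"

definition indets :: "('x, 'k::zero) mpolynomial \<Rightarrow> 'x set" where
  "indets p = (\<Union>e\<in>Poly_Mapping.keys p. Poly_Mapping.keys e)"

definition poly_ring :: "'x set \<Rightarrow> ('x, 'k::comm_ring_1) mpolynomial ring" where
  "poly_ring X =
     \<lparr>carrier = {p. indets p \<subseteq> X}, monoid.mult = (*), one = 1, zero = 0, add = (+)\<rparr>"

definition indet :: "'x \<Rightarrow> ('x, 'k::comm_ring_1) mpolynomial" where
  "indet x = Poly_Mapping.single (Poly_Mapping.single x 1) 1"

lemma poly_ring_cring: "cring (poly_ring X :: ('x, 'k::comm_ring_1) mpolynomial ring)"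
proof -
  have add: "indets (p + q) \<subseteq> X" if "indets p \<subseteq> X" "indets q \<subseteq> X"
    for p q :: "('x, 'k) mpolynomial"
    using that keys_add[of p q] unfolding indets_def by blast
  have mult: "indets (p * q) \<subseteq> X" if "indets p \<subseteq> X" "indets q \<subseteq> X"
    for p q :: "('x, 'k) mpolynomial"
  proof
    fix x assume "x \<in> indets (p * q)"
    then obtain e where e: "e \<in> Poly_Mapping.keys (p * q)" "x \<in> Poly_Mapping.keys e"
      unfolding indets_def by blast
    then obtain a b where ab: "a \<in> Poly_Mapping.keys p" "b \<in> Poly_Mapping.keys q" "e = a + b"
      using keys_mult[of p q] by blast
    then have "x \<in> Poly_Mapping.keys a \<union> Poly_Mapping.keys b" using e(2) keys_add[of a b] by blast
    then show "x \<in> X" using that ab unfolding indets_def by blast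
  qed
  have neg: "indets (- p) = indets p" for p :: "('x, 'k) mpolynomial"
    by (simp add: indets_def)
  show ?thesis
  proof (intro cringI abelian_groupI comm_monoidI)
    fix p :: "('x, 'k) mpolynomial" assume "p \<in> carrier (poly_ring X)"
    then show "\<exists>q\<in>carrier (poly_ring X). q \<oplus>\<^bsub>poly_ring X\<^esub> p = \<zero>\<^bsub>poly_ring X\<^esub>"
      by (intro bexI[of _ "- p"]) (auto simp: poly_ring_def neg)
  qed (use add mult in \<open>auto simp: poly_ring_def indets_def algebra_simps\<close>)
qed

definition P_gens :: "nat \<Rightarrow> nat \<Rightarrow> (tableau, 'k::comm_ring_1) mpolynomial set" where
  "P_gens n m = {indet T1 * indet T2 - indet T3 * indet T4 | T1 T2 T3 T4.
     {T1, T2, T3, T4} \<subseteq> G n m \<and> distinct [T1, T2, T3, T4] \<and> T1 \<star> T2 = T3 \<star> T4}"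

definition P_ideal :: "nat \<Rightarrow> nat \<Rightarrow> (tableau, 'k::comm_ring_1) mpolynomial set" where
  "P_ideal n m = genideal (poly_ring (G n m)) (P_gens n m)"

(* Meaningful for finitely generated ideals only, since LEAST over an empty set is
   unspecified; P_ideal is one of these, as G n m is finite. *)
definition min_num_gens :: "('a, 'b) ring_scheme \<Rightarrow> 'a set \<Rightarrow> nat" where
  "min_num_gens R I =
     (LEAST c. \<exists>S. finite S \<and> S \<subseteq> carrier R \<and> genideal R S = I \<and> card S = c)"

definition varsigma_P :: "'k::comm_ring_1 itself \<Rightarrow> nat \<Rightarrow> nat \<Rightarrow> nat" where
  "varsigma_P _ n m =
     min_num_gens (poly_ring (G n m)) (P_ideal n m :: (tableau, 'k) mpolynomial set)"

end

theory Submission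
  imports Defs
begin

text \<open>
  A one-column tableau is a strictly increasing list of entries, equivalently a nonempty set of at
  most \<open>n\<close> elements of \<open>{1..m}\<close>. Pad a column at the bottom with infinite entries. The columns
  of \<open>T1 \<star> T2\<close> are then the entrywise minimum and the entrywise maximum of the two given
  columns, so \<open>\<star>\<close> records exactly the meet and the join in the distributive lattice of columns,
  and \<open>P_ideal n m\<close> is the Hibi ideal of this lattice. It is generated by the straightening relations
  \<open>T1 T2 - (T1 \<and> T2) (T1 \<or> T2)\<close> of the incomparable pairs \<open>{T1, T2}\<close>
  (\<open>P_ideal_eq\<close>): for comparable factors the relation is zero, and a generator
  \<open>T1 T2 - T3 T4\<close> with \<open>T1 \<star> T2 = T3 \<star> T4\<close> is the difference of two straightening relations.

  These relations are a minimal system of generators. All of them are quadratic forms, so modulo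
  terms of higher degree an element of the ideal is a linear combination of them. The monomial
  \<open>T1 T2\<close> of an incomparable pair occurs in no relation but its own, since \<open>T1 \<and> T2\<close> and
  \<open>T1 \<or> T2\<close> are comparable. The coefficients at these monomials therefore map any system of
  generators to a spanning set of a vector space whose dimension is the number of incomparable pairs
  (\<open>min_num_gens_eq_card\<close>, \<open>varsigma_P_eq\<close>).

  It remains to count the unordered incomparable pairs. A column lies below another one in the
  lattice iff for every \<open>t\<close> it has at least as many entries up to \<open>t\<close> (\<open>col_le_iff_card\<close>).
  Hence for sets with \<open>card A \<le> card B\<close> the relation between \<open>A\<close> and \<open>B\<close> is a ballot
  problem: \<open>B\<close> lies below \<open>A\<close> unless \<open>A\<close> gets ahead of \<open>B\<close> at some \<open>t\<close>. Andre's
  reflection turns the pairs with \<open>card (A - B) = k\<close> and \<open>card (B - A) = j\<close> in which this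
  happens into all the pairs with \<open>card (A - B) = j + 1\<close> and \<open>card (B - A) = k - 1\<close>
  (\<open>card_overtaking_set_pairs\<close>), which are the fraction \<open>k / (j + 1)\<close> of all pairs with the
  given \<open>k\<close> and \<open>j\<close>. With \<open>i = card A\<close> this is the inner sum of the formula. Two distinct
  columns of equal height are incomparable iff each gets ahead of the other, and at least one of them
  does; inclusion-exclusion for these two events gives the correction \<open>- 1/2\<close>
  (\<open>card_incomparable_pairs\<close>).
\<close>

section \<open>Minimal generators of ideals with separated leading monomials\<close>

lemma single_add_eq_single_addD:
  fixes u x y :: 'x
  assumes "Poly_Mapping.single u (1::nat) + c = Poly_Mapping.single x 1 + Poly_Mapping.single y 1"
  shows "(u = x \<and> c = Poly_Mapping.single y 1) \<or> (u = y \<and> c = Poly_Mapping.single x 1)"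
proof -
  have "Poly_Mapping.lookup (Poly_Mapping.single u (1::nat) + c) u \<noteq> 0"
    by (simp add: lookup_add)
  then have "u = x \<or> u = y"
    unfolding assms by (auto simp: lookup_add lookup_single when_def split: if_splits)
  then show ?thesis
    using assms by (metis add.commute add_left_cancel)
qed

text \<open>No quadratic monomial properly divides another one.\<close>

lemma add_quadratic_eq_quadraticD:
  assumes "a + (Poly_Mapping.single u 1 + Poly_Mapping.single v 1) =
    Poly_Mapping.single x 1 + Poly_Mapping.single y (1::nat)"
  shows "a = 0"
proof -
  have "Poly_Mapping.single u 1 + (Poly_Mapping.single v 1 + a) =
      Poly_Mapping.single x 1 + Poly_Mapping.single y (1::nat)"
    using assms by (simp only: ac_simps)
  from single_add_eq_single_addD [OF this]
  obtain z where z: "Poly_Mapping.single v 1 + a = Poly_Mapping.single z (1::nat)"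
    by blast
  have "Poly_Mapping.lookup a v = 0 \<and> z = v"
    using arg_cong [OF z, of "\<lambda>e. Poly_Mapping.lookup e v"]
    by (auto simp: lookup_add lookup_single when_def split: if_splits)
  then show ?thesis using z by simp
qed

lemma indet_mult_indet:
  "indet x * indet y =
    (Poly_Mapping.single (Poly_Mapping.single x 1 + Poly_Mapping.single y 1) 1
      :: ('x, 'k::comm_ring_1) mpolynomial)"
  by (simp add: indet_def mult_single)

lemma carrier_poly_ring [simp]: "p \<in> carrier (poly_ring X) \<longleftrightarrow> indets p \<subseteq> X"
  and mult_poly_ring [simp]: "p \<otimes>\<^bsub>poly_ring X\<^esub> q = p * q"
  and add_poly_ring [simp]: "p \<oplus>\<^bsub>poly_ring X\<^esub> q = p + q"
  and zero_poly_ring [simp]: "\<zero>\<^bsub>poly_ring X\<^esub> = 0"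
  and one_poly_ring [simp]: "\<one>\<^bsub>poly_ring X\<^esub> = 1"
  by (auto simp: poly_ring_def)

text \<open>
  Scalars are embedded as constant polynomials, so that scaling is a case of multiplication in the ring.
\<close>

interpretation mpoly: vector_space
  "\<lambda>(c::'k::field) (p::('x, 'k) mpolynomial). Poly_Mapping.single 0 c * p"
  by unfold_locales (auto simp: algebra_simps single_add mult_single mult.assoc [symmetric])

text \<open>
  The part of a polynomial supported on \<open>E\<close>, as a polynomial. Values in the polynomials rather
  than coefficient families keep the vector space of \<open>mpoly\<close> as the target of this linear map.
\<close>

definition restrict_to :: "('x \<Rightarrow>\<^sub>0 nat) set \<Rightarrow> ('x, 'k::comm_ring_1) mpolynomial \<Rightarrow> ('x, 'k) mpolynomial"
  where "restrict_to E p = (\<Sum>e\<in>E. Poly_Mapping.single e (Poly_Mapping.lookup p e))"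

text \<open>
  A local substitute for having no terms of degree less than two: the proper divisors of a quadratic
  monomial are \<open>1\<close> and its indeterminates.
\<close>

definition vanishes_on_proper_divisors :: "('x \<Rightarrow>\<^sub>0 nat) set \<Rightarrow> ('x, 'k::comm_ring_1) mpolynomial \<Rightarrow> bool"
  where "vanishes_on_proper_divisors E p \<longleftrightarrow> (\<forall>a b. a + b \<in> E \<longrightarrow> a \<noteq> 0 \<longrightarrow> Poly_Mapping.lookup p b = 0)"

text \<open>
  Of all factorisations of \<open>e\<close>, only the one with trivial first factor can have its second
  factor in the support of \<open>p\<close>. Thus the polynomial ring acts on the coefficients in \<open>E\<close> through its constant terms.
\<close>

lemma lookup_mult_vanishes_on_proper_divisors:
  assumes p: "vanishes_on_proper_divisors E p" and e: "e \<in> E"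
  shows "Poly_Mapping.lookup (r * p) e = Poly_Mapping.lookup r 0 * Poly_Mapping.lookup p e"
proof -
  have inner: "(\<Sum>b. Poly_Mapping.lookup p b when e = a + b) =
      (Poly_Mapping.lookup p e when a = 0)" for a
  proof (cases "a = 0")
    case True
    then show ?thesis by simp
  next
    case False
    then have "(Poly_Mapping.lookup p b when e = a + b) = 0" for b
      using p e by (auto simp: vanishes_on_proper_divisors_def when_def)
    then show ?thesis using False by simp
  qed
  have "Poly_Mapping.lookup (r * p) e =
      (\<Sum>a. Poly_Mapping.lookup r a * (Poly_Mapping.lookup p e when a = 0))"
    by (simp add: lookup_mult inner)
  also have "\<dots> = (\<Sum>a. Poly_Mapping.lookup r a * Poly_Mapping.lookup p e when a = 0)"
    by (simp add: mult_when)
  finally show ?thesis by simp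
qed

lemma vanishes_on_proper_divisors_mult:
  assumes p: "vanishes_on_proper_divisors E p"
  shows "vanishes_on_proper_divisors E (r * p)"
  unfolding vanishes_on_proper_divisors_def
proof (intro allI impI)
  fix a b assume ab: "a + b \<in> E" "a \<noteq> (0::'a \<Rightarrow>\<^sub>0 nat)"
  have "vanishes_on_proper_divisors {b} p"
    unfolding vanishes_on_proper_divisors_def
  proof (intro allI impI)
    fix c d assume "c + d \<in> {b}" "c \<noteq> (0::'a \<Rightarrow>\<^sub>0 nat)"
    then have "a + c + d \<in> E" using ab by (auto simp: add.assoc)
    moreover have "a + c \<noteq> 0"
    proof
      assume "a + c = 0"
      then have "Poly_Mapping.lookup a x + Poly_Mapping.lookup c x = 0" for x
        by (metis lookup_add lookup_zero)
      then have "a = 0" by (intro poly_mapping_eqI) simp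
      with ab show False by simp
    qed
    ultimately show "Poly_Mapping.lookup p d = 0"
      using p unfolding vanishes_on_proper_divisors_def by blast
  qed
  then have "Poly_Mapping.lookup (r * p) b = Poly_Mapping.lookup r 0 * Poly_Mapping.lookup p b"
    by (rule lookup_mult_vanishes_on_proper_divisors) simp
  then show "Poly_Mapping.lookup (r * p) b = 0"
    using p ab by (simp add: vanishes_on_proper_divisors_def)
qed

lemma restrict_to_mult:
  assumes "vanishes_on_proper_divisors E p"
  shows "restrict_to E (r * p) = Poly_Mapping.single 0 (Poly_Mapping.lookup r 0) * restrict_to E p"
  unfolding restrict_to_def sum_distrib_left
  by (intro sum.cong) (auto simp: lookup_mult_vanishes_on_proper_divisors [OF assms] mult_single)

lemma restrict_to_add: "restrict_to E (p + q) = restrict_to E p + restrict_to E q"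
  by (simp add: restrict_to_def lookup_add single_add sum.distrib)

lemma ideal_minus_closed:
  fixes p q :: "('x, 'k::comm_ring_1) mpolynomial"
  assumes I: "ideal I (poly_ring X)" and "p \<in> I" "q \<in> I"
  shows "p - q \<in> I"
proof -
  interpret ideal I "poly_ring X" by fact
  have "indets (- 1 :: ('x, 'k) mpolynomial) \<subseteq> X"
    by (auto simp: indets_def)
  then have "- 1 \<otimes>\<^bsub>poly_ring X\<^esub> q \<in> I"
    using assms(3) by (intro I_l_closed) auto
  then have "p \<oplus>\<^bsub>poly_ring X\<^esub> (- 1 \<otimes>\<^bsub>poly_ring X\<^esub> q) \<in> I"
    by (rule additive_subgroup.a_closed [OF is_additive_subgroup assms(2)])
  then show ?thesis by simp
qed

text \<open>
  On the polynomials that vanish on the proper divisors, multiplication acts on the coefficients in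
  \<open>E\<close> by scalars. So every system of homogeneous linear conditions on these coefficients cuts out
  an ideal.
\<close>

lemma ideal_restrict_to:
  fixes W :: "('x, 'k::field) mpolynomial set"
  assumes W: "mpoly.subspace W"
  shows "ideal {p \<in> carrier (poly_ring X). vanishes_on_proper_divisors E p \<and> restrict_to E p \<in> W} (poly_ring X)"
    (is "ideal ?J ?R")
proof -
  interpret cring ?R by (rule poly_ring_cring)
  have mult: "r * p \<in> ?J" if "p \<in> ?J" "r \<in> carrier ?R" for p r
  proof -
    have "r \<otimes>\<^bsub>?R\<^esub> p \<in> carrier ?R" using that by (intro m_closed) auto
    then show ?thesis
      using that W
      by (auto simp: vanishes_on_proper_divisors_mult restrict_to_mult intro: mpoly.subspace_scale)
  qed
  have add: "p + q \<in> ?J" if "p \<in> ?J" "q \<in> ?J" for p q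
  proof -
    have "p \<oplus>\<^bsub>?R\<^esub> q \<in> carrier ?R" using that by (intro a_closed) auto
    then show ?thesis
      using that W
      by (auto simp: vanishes_on_proper_divisors_def lookup_add restrict_to_add intro: mpoly.subspace_add)
  qed
  have neg: "- p \<in> ?J" if "p \<in> ?J" for p
  proof -
    have "indets (- 1 :: ('x, 'k) mpolynomial) \<subseteq> X"
      by (auto simp: indets_def)
    then show ?thesis using mult [OF that, of "- 1"] by simp
  qed
  have zero: "0 \<in> ?J"
    using W by (auto simp: indets_def vanishes_on_proper_divisors_def restrict_to_def mpoly.subspace_0)
  show ?thesis
  proof (rule idealI)
    show "ring ?R" by unfold_locales
    show "subgroup ?J (add_monoid ?R)"
    proof (rule group.subgroupI)
      show "group (add_monoid ?R)" by (rule a_group)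
      show "?J \<subseteq> carrier (add_monoid ?R)" by auto
      show "?J \<noteq> {}" using zero by blast
      fix p assume p: "p \<in> ?J"
      then have "- p \<in> carrier ?R" using neg by blast
      then have "\<ominus>\<^bsub>?R\<^esub> p = - p"
        using p by (intro minus_equality) auto
      then show "inv\<^bsub>add_monoid ?R\<^esub> p \<in> ?J"
        using neg [OF p] by (simp add: a_inv_def)
    next
      fix p q assume "p \<in> ?J" "q \<in> ?J"
      then show "p \<otimes>\<^bsub>add_monoid ?R\<^esub> q \<in> ?J" using add by simp
    qed
  next
    fix p r assume "p \<in> ?J" "r \<in> carrier ?R"
    then show "r \<otimes>\<^bsub>?R\<^esub> p \<in> ?J" "p \<otimes>\<^bsub>?R\<^esub> r \<in> ?J"
      using mult by (auto simp: mult.commute)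
  qed
qed

text \<open>
  A graded Nakayama argument without a grading. The elements of the ideal vanish on the proper
  divisors of the monomials \<open>lm g\<close>, hence the restriction to these monomials takes the ideal into
  the linear span of the restrictions of any of its generating systems. The restrictions of the
  elements of \<open>S\<close> itself are distinct monomials, thus linearly independent.
\<close>

lemma min_num_gens_eq_card:
  fixes S :: "('x, 'k::field) mpolynomial set"
  assumes fin: "finite S" and S: "S \<subseteq> carrier (poly_ring X)"
    and van: "\<And>g. g \<in> S \<Longrightarrow> vanishes_on_proper_divisors (lm ` S) g"
    and lm: "\<And>g h. g \<in> S \<Longrightarrow> h \<in> S \<Longrightarrow> Poly_Mapping.lookup g (lm h) = (if g = h then 1 else 0)"
  shows "min_num_gens (poly_ring X) (genideal (poly_ring X) S) = card S"
  unfolding min_num_gens_def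
proof (rule Least_equality)
  let ?R = "poly_ring X :: ('x, 'k) mpolynomial ring"
  interpret cring ?R by (rule poly_ring_cring)
  show "\<exists>S'. finite S' \<and> S' \<subseteq> carrier ?R \<and> genideal ?R S' = genideal ?R S \<and> card S' = card S"
    using fin S by blast
  fix c assume "\<exists>S'. finite S' \<and> S' \<subseteq> carrier ?R \<and> genideal ?R S' = genideal ?R S \<and> card S' = c"
  then obtain S' where S': "finite S'" "S' \<subseteq> carrier ?R" "genideal ?R S' = genideal ?R S" "card S' = c"
    by blast
  define J where "J W = {p \<in> carrier ?R. vanishes_on_proper_divisors (lm ` S) p \<and> restrict_to (lm ` S) p \<in> W}" for W
  have inj: "inj_on lm S"
  proof (rule inj_onI)
    fix g h assume "g \<in> S" "h \<in> S" "lm g = lm h"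
    then show "g = h" using lm [of g g] lm [of g h] by (auto split: if_splits)
  qed
  have ideal_J: "ideal (J W) ?R" if "mpoly.subspace W" for W
    unfolding J_def using that by (rule ideal_restrict_to)
  have "genideal ?R S \<subseteq> J UNIV"
    using S van by (intro genideal_minimal ideal_J) (auto simp: J_def simp del: carrier_poly_ring)
  moreover have "S' \<subseteq> genideal ?R S"
    using genideal_self [OF S'(2)] S'(3) by simp
  ultimately have "S' \<subseteq> J (mpoly.span (restrict_to (lm ` S) ` S'))"
    by (auto simp: J_def intro: mpoly.span_base)
  then have "genideal ?R S' \<subseteq> J (mpoly.span (restrict_to (lm ` S) ` S'))"
    by (intro genideal_minimal ideal_J mpoly.subspace_span)
  then have span: "restrict_to (lm ` S) g \<in> mpoly.span (restrict_to (lm ` S) ` S')" if "g \<in> S" for g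
    using that genideal_self [OF S] S'(3) by (auto simp: J_def)
  have restrict_S: "restrict_to (lm ` S) g = Poly_Mapping.single (lm g) 1" if "g \<in> S" for g
  proof -
    have "restrict_to (lm ` S) g = (\<Sum>h\<in>S. Poly_Mapping.single (lm h) (Poly_Mapping.lookup g (lm h)))"
      by (simp add: restrict_to_def sum.reindex [OF inj])
    also have "\<dots> = (\<Sum>h\<in>S. if h = g then Poly_Mapping.single (lm h) 1 else 0)"
      using that by (intro sum.cong) (auto simp: lm)
    finally show ?thesis using that fin by simp
  qed
  let ?b = "\<lambda>g. Poly_Mapping.single (lm g) (1::'k)"
  have inj_b: "inj_on ?b S"
  proof (rule inj_onI)
    fix g h assume *: "g \<in> S" "h \<in> S" "?b g = ?b h"
    have "Poly_Mapping.keys (?b g) = Poly_Mapping.keys (?b h)" by (simp only: *(3))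
    then have "lm g = lm h" by simp
    then show "g = h" using * inj by (auto simp: inj_on_def)
  qed
  have "mpoly.independent (?b ` S)"
  proof (rule mpoly.independent_if_scalars_zero)
    show "finite (?b ` S)" using fin by simp
    fix f x assume *: "(\<Sum>x\<in>?b ` S. Poly_Mapping.single 0 (f x) * x) = 0" and x: "x \<in> ?b ` S"
    from x obtain g where g: "g \<in> S" "x = ?b g" by blast
    have "0 = Poly_Mapping.lookup (\<Sum>x\<in>?b ` S. Poly_Mapping.single 0 (f x) * x) (lm g)"
      using * by simp
    also have "\<dots> = (\<Sum>h\<in>S. Poly_Mapping.lookup (Poly_Mapping.single (lm h) (f (?b h))) (lm g))"
      by (simp add: sum.reindex [OF inj_b] lookup_sum mult_single)
    also have "\<dots> = (\<Sum>h\<in>S. if h = g then f (?b h) else 0)"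
      using g inj by (intro sum.cong) (auto simp: lookup_single when_def inj_on_def)
    also have "\<dots> = f x" using g fin by simp
    finally show "f x = 0" by simp
  qed
  moreover have "?b ` S \<subseteq> mpoly.span (restrict_to (lm ` S) ` S')"
    using span by (auto simp: restrict_S)
  ultimately have "card (?b ` S) \<le> card (restrict_to (lm ` S) ` S')"
    using mpoly.independent_span_bound S'(1) by blast
  also have "\<dots> \<le> c" using card_image_le [OF S'(1)] S'(4) by simp
  finally show "card S \<le> c" by (simp add: card_image [OF inj_b])
qed

section \<open>The lattice of columns\<close>

abbreviation col :: "nat list \<Rightarrow> tableau" where
  "col xs \<equiv> map (\<lambda>x. [x]) xs"

lemma inj_col: "col xs = col ys \<longleftrightarrow> xs = ys"
  by (rule inj_map_eq_map) (simp add: inj_def)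

text \<open>The entries, from top to bottom, of the tableaux in \<open>G n m\<close>.\<close>

definition columns :: "nat \<Rightarrow> nat \<Rightarrow> nat list set" where
  "columns n m = {xs. sorted_wrt (<) xs \<and> xs \<noteq> [] \<and> length xs \<le> n \<and> set xs \<subseteq> {1..m}}"

lemma G_eq:
  "G n m = col ` columns n m"
proof (intro equalityI subsetI)
  fix T assume T: "T \<in> G n m"
  have ne: "T \<noteq> []" and hd: "length (T ! 0) = 1"
    using T by (auto simp: G_def num_columns_def row_def split: if_splits)
  have part: "sorted_wrt (\<ge>) (map length T)" "\<And>r. r \<in> set T \<Longrightarrow> r \<noteq> []"
    using T by (auto simp: G_def SSYT_def semistandard_def is_partition_def shape_def)
  have len: "length r = 1" if r: "r \<in> set T" for r
  proof -
    obtain i where i: "i < length T" "r = T ! i" using r by (metis in_set_conv_nth)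
    have "length (T ! i) \<le> length (T ! 0)"
      using part(1) i by (cases i) (auto simp: sorted_wrt_iff_nth_less)
    moreover have "length r \<noteq> 0" using part(2) [OF r] by simp
    ultimately show ?thesis using hd unfolding i(2) by linarith
  qed
  define xs where "xs = map hd T"
  have T_eq: "T = col xs"
  proof -
    have "map (\<lambda>r. [hd r]) T = map (\<lambda>r. r) T"
    proof (rule map_cong [OF refl])
      fix r assume "r \<in> set T"
      then have "length r = 1" by (rule len)
      then show "[hd r] = r" by (cases r) auto
    qed
    then show ?thesis by (simp add: xs_def comp_def)
  qed
  have "xs ! i < xs ! Suc i" if i: "Suc i < length xs" for i
  proof -
    have "semistandard (col xs)" using T by (simp add: T_eq G_def SSYT_def)
    then have "col xs ! i ! 0 < col xs ! Suc i ! 0"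
      using i unfolding semistandard_def by (metis length_map length_Cons nth_map zero_less_Suc)
    then show ?thesis using i by simp
  qed
  then have "sorted_wrt (<) xs"
    by (simp add: sorted_wrt_iff_nth_Suc_transp transp_on_less)
  then have "xs \<in> columns n m"
    using T ne unfolding T_eq by (auto simp: G_def SSYT_def columns_def)
  then show "T \<in> col ` columns n m" using T_eq by blast
next
  fix T assume "T \<in> col ` columns n m"
  then obtain xs where xs: "xs \<in> columns n m" "T = col xs" by blast
  then show "T \<in> G n m"
    by (auto simp: columns_def G_def SSYT_def semistandard_def is_partition_def shape_def num_columns_def
        row_def sorted_wrt_iff_nth_less comp_def)
qed

text \<open>
  Entrywise minimum and maximum of two columns, where a column that is exhausted continues with
  infinite entries: the minimum keeps the tail of the longer column and the maximum stops with the
  shorter one.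
\<close>

fun col_meet :: "nat list \<Rightarrow> nat list \<Rightarrow> nat list" where
  "col_meet (x # xs) (y # ys) = min x y # col_meet xs ys"
| "col_meet [] ys = ys"
| "col_meet xs [] = xs"

fun col_join :: "nat list \<Rightarrow> nat list \<Rightarrow> nat list" where
  "col_join (x # xs) (y # ys) = max x y # col_join xs ys"
| "col_join _ _ = []"

text \<open>
  The order of the lattice of columns under the same convention, so that the longer columns are the
  smaller ones.
\<close>

fun col_le :: "nat list \<Rightarrow> nat list \<Rightarrow> bool" where
  "col_le _ [] \<longleftrightarrow> True"
| "col_le [] (y # ys) \<longleftrightarrow> False"
| "col_le (x # xs) (y # ys) \<longleftrightarrow> x \<le> y \<and> col_le xs ys"

lemma col_meet_Nil2 [simp]: "col_meet xs [] = xs"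
  by (cases xs) auto

lemma col_join_Nil2 [simp]: "col_join xs [] = []"
  by (cases xs) auto

lemma star_Cons: "(r # T) \<star> (s # U) = sort (r @ s) # T \<star> U"
proof -
  have "max (length (r # T)) (length (s # U)) = Suc (max (length T) (length U))" by simp
  moreover have "row (a # V) 0 = a" "row (a # V) (Suc i) = row V i" for a V i
    by (simp_all add: row_def)
  ultimately show ?thesis
    unfolding star_def by (simp only: map_upt_Suc)
qed

lemma star_Nil: "[] \<star> U = map sort U" "U \<star> [] = map sort U"
  by (intro nth_equalityI; simp add: star_def row_def)+

lemma star_col:
  "col xs \<star> col ys = col (col_meet xs ys) \<star> col (col_join xs ys)"
  by (induction xs ys rule: col_meet.induct) (auto simp: star_Cons star_Nil min_def max_def)

text \<open>The columns are numbered from zero, the leftmost one first.\<close>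

definition column :: "tableau \<Rightarrow> nat \<Rightarrow> tableau" where
  "column T j = map (\<lambda>r. [r ! j]) (filter (\<lambda>r. j < length r) T)"

lemma column_star_col:
  "column (col xs \<star> col ys) 0 = col (col_meet xs ys)"
  "column (col xs \<star> col ys) 1 = col (col_join xs ys)"
  by (induction xs ys rule: col_meet.induct)
    (auto simp: column_def star_Cons star_Nil min_def max_def filter_empty_conv)

text \<open>
  The meet and the join are the two columns of the product, so they can be read off from it.
\<close>

lemma star_col_eq_iff:
  "col xs \<star> col ys = col xs' \<star> col ys' \<longleftrightarrow> col_meet xs ys = col_meet xs' ys' \<and> col_join xs ys = col_join xs' ys'"
  by (metis column_star_col inj_col star_col)

lemma col_meet_commute: "col_meet xs ys = col_meet ys xs"
  and col_join_commute: "col_join xs ys = col_join ys xs"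
  by (induction xs ys rule: col_meet.induct) (auto simp: min.commute max.commute)

lemma length_col_meet: "length (col_meet xs ys) = max (length xs) (length ys)"
  by (induction xs ys rule: col_meet.induct) auto

lemma length_col_join: "length (col_join xs ys) = min (length xs) (length ys)"
  by (induction xs ys rule: col_meet.induct) auto

lemma set_col_meet: "set (col_meet xs ys) \<subseteq> set xs \<union> set ys"
  by (induction xs ys rule: col_meet.induct) (auto simp: min_def)

lemma set_col_join: "z \<in> set (col_join xs ys) \<Longrightarrow> \<exists>x\<in>set xs. \<exists>y\<in>set ys. z = max x y"
  by (induction xs ys rule: col_meet.induct) auto

lemma sorted_col_meet:
  "sorted_wrt (<) xs \<Longrightarrow> sorted_wrt (<) ys \<Longrightarrow> sorted_wrt (<) (col_meet xs ys)"
proof (induction xs ys rule: col_meet.induct)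
  case (1 x xs y ys)
  then show ?case using set_col_meet [of xs ys] by (fastforce simp: min_less_iff_disj)
qed auto

lemma sorted_col_join:
  "sorted_wrt (<) xs \<Longrightarrow> sorted_wrt (<) ys \<Longrightarrow> sorted_wrt (<) (col_join xs ys)"
proof (induction xs ys rule: col_meet.induct)
  case (1 x xs y ys)
  then show ?case by (auto dest!: set_col_join simp: less_max_iff_disj)
qed auto

lemma col_le_refl: "col_le xs xs"
  by (induction xs) auto

lemma col_le_col_meet_col_join: "col_le (col_meet xs ys) (col_join xs ys)"
  by (induction xs ys rule: col_meet.induct) auto

lemma col_meet_eq_iff: "col_meet xs ys = xs \<longleftrightarrow> col_le xs ys"
  by (induction xs ys rule: col_le.induct) auto

lemma col_join_eq_iff: "col_join xs ys = ys \<longleftrightarrow> col_le xs ys"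
  by (induction xs ys rule: col_le.induct) auto

lemma col_meet_eq_col_joinD: "col_meet xs ys = col_join xs ys \<Longrightarrow> xs = ys"
  by (induction xs ys rule: col_meet.induct) (auto simp: min_def max_def split: if_splits)

lemma col_le_conv_nth:
  "col_le xs ys \<longleftrightarrow> length ys \<le> length xs \<and> (\<forall>i<length ys. xs ! i \<le> ys ! i)"
  by (induction xs ys rule: col_le.induct) (auto simp: All_less_Suc2)

text \<open>
  Counting the entries up to \<open>t\<close> is the Galois adjoint of reading off an entry. This translates
  between the entrywise order and the comparison of counting functions.
\<close>

lemma less_card_Int_atMost_iff:
  "sorted_wrt (<) xs \<Longrightarrow> i < card (set xs \<inter> {..t}) \<longleftrightarrow> i < length xs \<and> xs ! i \<le> (t::nat)"
proof (induction xs arbitrary: i)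
  case (Cons x xs)
  show ?case
  proof (cases "x \<le> t")
    case True
    then have "set (x # xs) \<inter> {..t} = insert x (set xs \<inter> {..t})" by auto
    moreover have "x \<notin> set xs" using Cons.prems by auto
    ultimately have "card (set (x # xs) \<inter> {..t}) = Suc (card (set xs \<inter> {..t}))" by simp
    then show ?thesis using Cons True by (cases i) auto
  next
    case False
    then have "set (x # xs) \<inter> {..t} = {}" using Cons.prems by auto
    moreover have "x \<le> (x # xs) ! i" if "i < length (x # xs)" for i
      using that Cons.prems by (cases i) (auto intro: less_imp_le)
    ultimately show ?thesis using False by fastforce
  qed
qed simp

lemma col_le_iff_card:
  assumes "sorted_wrt (<) xs" "sorted_wrt (<) ys"
  shows "col_le xs ys \<longleftrightarrow> (\<forall>t. card (set ys \<inter> {..t}) \<le> card (set xs \<inter> {..t}))"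
proof -
  have "col_le xs ys \<longleftrightarrow> (\<forall>t i. i < length ys \<and> ys ! i \<le> t \<longrightarrow> i < length xs \<and> xs ! i \<le> t)"
  proof
    assume "col_le xs ys"
    then show "\<forall>t i. i < length ys \<and> ys ! i \<le> t \<longrightarrow> i < length xs \<and> xs ! i \<le> t"
      unfolding col_le_conv_nth by (auto intro: le_trans less_le_trans)
  next
    assume *: "\<forall>t i. i < length ys \<and> ys ! i \<le> t \<longrightarrow> i < length xs \<and> xs ! i \<le> t"
    then have "i < length xs \<and> xs ! i \<le> ys ! i" if "i < length ys" for i using that by blast
    then show "col_le xs ys"
      unfolding col_le_conv_nth by (metis linorder_not_le less_irrefl)
  qed
  also have "\<dots> \<longleftrightarrow> (\<forall>t i. i < card (set ys \<inter> {..t}) \<longrightarrow> i < card (set xs \<inter> {..t}))"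
    by (simp add: less_card_Int_atMost_iff assms)
  also have "\<dots> \<longleftrightarrow> (\<forall>t. card (set ys \<inter> {..t}) \<le> card (set xs \<inter> {..t}))"
  proof -
    have "(\<forall>i. i < a \<longrightarrow> i < b) \<longleftrightarrow> a \<le> b" for a b :: nat
      by (meson less_irrefl less_le_trans not_le)
    then show ?thesis by simp
  qed
  finally show ?thesis .
qed

section \<open>Reflection of pairs of sets\<close>

text \<open>
  Read \<open>0, 1, 2, \<dots>\<close> as the ballots of an election, with the elements of \<open>A\<close> as the votes for
  one candidate and those of \<open>B\<close> as the votes for the other; the first is ahead after ballot \<open>t\<close>.
\<close>

definition overtakes :: "nat set \<Rightarrow> nat set \<Rightarrow> nat \<Rightarrow> bool" where
  "overtakes A B t \<longleftrightarrow> card (B \<inter> {..t}) < card (A \<inter> {..t})"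

text \<open>
  Andre's reflection: all votes after the first moment of overtaking are given to the other candidate.
\<close>

definition switch :: "nat set \<times> nat set \<Rightarrow> nat set \<times> nat set" where
  "switch = (\<lambda>(A, B). let t = LEAST t. overtakes A B t in
     (A \<inter> {..t} \<union> B \<inter> {t<..}, B \<inter> {..t} \<union> A \<inter> {t<..}))"

definition set_pairs :: "nat \<Rightarrow> nat \<Rightarrow> nat \<Rightarrow> nat \<Rightarrow> (nat set \<times> nat set) set" where
  "set_pairs m c k j = {(A, B). A \<subseteq> {1..m} \<and> B \<subseteq> {1..m} \<and>
     card (A \<inter> B) = c \<and> card (A - B) = k \<and> card (B - A) = j}"

text \<open>
  Nothing changes up to the first moment of overtaking, so the switched pair has the same first
  moment. This makes the reflection an involution.
\<close>

lemma overtakes_switch: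
  assumes ov: "overtakes A B t0" and AB: "switch (A, B) = (A', B')"
  shows "(LEAST t. overtakes A' B' t) = (LEAST t. overtakes A B t)"
    and "overtakes A' B' (LEAST t. overtakes A B t)"
proof -
  let ?t = "LEAST t. overtakes A B t"
  have A': "A' = A \<inter> {..?t} \<union> B \<inter> {?t<..}" and B': "B' = B \<inter> {..?t} \<union> A \<inter> {?t<..}"
    using AB by (auto simp: switch_def Let_def)
  have same: "overtakes A' B' s \<longleftrightarrow> overtakes A B s" if "s \<le> ?t" for s
  proof -
    have "A' \<inter> {..s} = A \<inter> {..s}" "B' \<inter> {..s} = B \<inter> {..s}"
      using that by (auto simp: A' B')
    then show ?thesis by (simp add: overtakes_def)
  qed
  have "overtakes A B ?t" using ov by (rule LeastI)
  then show *: "overtakes A' B' ?t" using same by simp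
  show "(LEAST t. overtakes A' B' t) = ?t"
  proof (rule Least_equality [where P = "overtakes A' B'"])
    show "overtakes A' B' ?t" by fact
    fix s assume "overtakes A' B' s"
    then show "?t \<le> s" using same by (meson Least_le linear)
  qed
qed

lemma switch_switch:
  assumes "overtakes A B t"
  shows "switch (switch (A, B)) = (A, B)"
proof -
  obtain A' B' where AB: "switch (A, B) = (A', B')" by fastforce
  show ?thesis
    using overtakes_switch(1) [OF assms AB] AB
    by (auto simp: switch_def Let_def)
qed

text \<open>
  The difference of the counts grows by at most one at each step, hence it is exactly one when it
  becomes positive.
\<close>

lemma first_overtaking:
  assumes fin: "finite A" "finite B" and ov: "overtakes A B t0"
  defines "t \<equiv> LEAST t. overtakes A B t"
  shows "card (A \<inter> {..t}) = Suc (card (B \<inter> {..t}))"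
proof -
  have ovt: "overtakes A B t" unfolding t_def using ov by (rule LeastI)
  have "card (A \<inter> {..<t}) \<le> card (B \<inter> {..<t})"
  proof (cases t)
    case (Suc s)
    then have "\<not> overtakes A B s" unfolding t_def by (metis lessI not_less_Least)
    then show ?thesis by (simp add: overtakes_def Suc lessThan_Suc_atMost)
  qed simp
  moreover have "card (A \<inter> {..t}) \<le> Suc (card (A \<inter> {..<t}))"
  proof -
    have "card (A \<inter> {..t}) \<le> card (insert t (A \<inter> {..<t}))"
      using fin by (intro card_mono) auto
    then show ?thesis using fin by (simp add: card_insert_if)
  qed
  moreover have "card (B \<inter> {..<t}) \<le> card (B \<inter> {..t})"
    using fin by (intro card_mono) auto
  ultimately show ?thesis using ovt unfolding overtakes_def by linarith
qed

text \<open>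
  Up to and including the first moment of overtaking, \<open>A - B\<close> has one element more than
  \<open>B - A\<close>; after it the two sets exchange their elements. So their cardinalities \<open>k\<close> and \<open>j\<close> become
  \<open>j + 1\<close> and \<open>k - 1\<close>.
\<close>

lemma switch_set_pairs:
  assumes AB: "(A, B) \<in> set_pairs m c k j" and ov: "overtakes A B t0"
  shows "0 < k" and "switch (A, B) \<in> set_pairs m c (Suc j) (k - 1)"
proof -
  define t where "t = (LEAST t. overtakes A B t)"
  have sub: "A \<subseteq> {1..m}" "B \<subseteq> {1..m}" using AB by (auto simp: set_pairs_def)
  then have fin: "finite A" "finite B" by (auto intro: finite_subset)
  obtain A' B' where A'B': "switch (A, B) = (A', B')" by fastforce
  then have A': "A' = A \<inter> {..t} \<union> B \<inter> {t<..}" and B': "B' = B \<inter> {..t} \<union> A \<inter> {t<..}"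
    by (auto simp: switch_def Let_def t_def)
  let ?a1 = "card ((A - B) \<inter> {..t})" and ?a2 = "card ((A - B) \<inter> {t<..})"
  let ?b1 = "card ((B - A) \<inter> {..t})" and ?b2 = "card ((B - A) \<inter> {t<..})"
  have split: "card (X \<inter> {..t} \<union> Y \<inter> {t<..}) = card (X \<inter> {..t}) + card (Y \<inter> {t<..})"
    if "finite X" "finite Y" for X Y :: "nat set"
    using that by (intro card_Un_disjoint) auto
  have "X = X \<inter> {..t} \<union> X \<inter> {t<..}" for X by auto
  then have split': "card X = card (X \<inter> {..t}) + card (X \<inter> {t<..})" if "finite X" for X
    using split [OF that that] by simp
  have k: "k = ?a1 + ?a2" and j: "j = ?b1 + ?b2"
    using AB fin split' [of "A - B"] split' [of "B - A"] by (auto simp: set_pairs_def)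
  have diff: "card (X \<inter> {..t}) = card ((X - Y) \<inter> {..t}) + card (X \<inter> Y \<inter> {..t})"
    if "finite X" for X Y :: "nat set"
  proof -
    have "X \<inter> {..t} = (X - Y) \<inter> {..t} \<union> X \<inter> Y \<inter> {..t}" by auto
    then have "card (X \<inter> {..t}) = card ((X - Y) \<inter> {..t} \<union> X \<inter> Y \<inter> {..t})" by simp
    also have "\<dots> = card ((X - Y) \<inter> {..t}) + card (X \<inter> Y \<inter> {..t})"
      using that by (intro card_Un_disjoint) auto
    finally show ?thesis .
  qed
  have "?a1 = Suc ?b1"
    using first_overtaking [OF fin ov] diff [OF fin(1), of B] diff [OF fin(2), of A]
    by (simp add: t_def Int_commute)
  moreover have "card (A' - B') = ?a1 + ?b2" "card (B' - A') = ?b1 + ?a2"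
  proof -
    have "A' - B' = (A - B) \<inter> {..t} \<union> (B - A) \<inter> {t<..}"
      "B' - A' = (B - A) \<inter> {..t} \<union> (A - B) \<inter> {t<..}"
      by (auto simp: A' B')
    then show "card (A' - B') = ?a1 + ?b2" "card (B' - A') = ?b1 + ?a2"
      using fin by (simp_all add: split)
  qed
  moreover have "A' \<inter> B' = A \<inter> B" by (auto simp: A' B')
  ultimately show "0 < k" "switch (A, B) \<in> set_pairs m c (Suc j) (k - 1)"
    using k j sub AB unfolding A'B' by (auto simp: set_pairs_def A' B')
qed

lemma overtakes_if_card_less:
  assumes "(A, B) \<in> set_pairs m c k j" "j < k"
  shows "overtakes A B m"
proof -
  have sub: "A \<subseteq> {1..m}" "B \<subseteq> {1..m}" using assms by (auto simp: set_pairs_def)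
  then have fin: "finite A" "finite B" by (auto intro: finite_subset)
  have "A \<inter> {..m} = A" "B \<inter> {..m} = B" using sub by auto
  moreover have "card A = card (A \<inter> B) + card (A - B)" "card B = card (A \<inter> B) + card (B - A)"
    using fin by (metis card_Int_Diff Int_commute)+
  ultimately show ?thesis using assms by (simp add: overtakes_def set_pairs_def)
qed

text \<open>
  The ballot theorem by reflection. The target consists of all pairs of the new type because there
  \<open>A\<close> is larger than \<open>B\<close> and must overtake at the latest at \<open>m\<close>.
\<close>

lemma card_overtaking_set_pairs:
  assumes "1 \<le> k" "k \<le> Suc j"
  shows "card {(A, B) \<in> set_pairs m c k j. \<exists>t. overtakes A B t} = card (set_pairs m c (Suc j) (k - 1))"
proof (rule bij_betw_same_card [of switch], rule bij_betw_byWitness [of _ switch])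
  let ?P = "{(A, B) \<in> set_pairs m c k j. \<exists>t. overtakes A B t}"
  let ?Q = "set_pairs m c (Suc j) (k - 1)"
  have ovQ: "overtakes A B m" if "(A, B) \<in> ?Q" for A B
    using that assms by (intro overtakes_if_card_less) auto
  show "\<forall>p\<in>?P. switch (switch p) = p" using switch_switch by auto
  show "\<forall>p\<in>?Q. switch (switch p) = p"
  proof clarify
    fix A B assume "(A, B) \<in> ?Q"
    from switch_switch [OF ovQ [OF this]] show "switch (switch (A, B)) = (A, B)" .
  qed
  show "switch ` ?P \<subseteq> ?Q" using switch_set_pairs(2) by auto
  show "switch ` ?Q \<subseteq> ?P"
  proof (rule image_subsetI)
    fix p assume "p \<in> ?Q"
    moreover obtain A B where AB: "p = (A, B)" by fastforce
    moreover obtain A' B' where A'B': "switch (A, B) = (A', B')" by fastforce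
    ultimately have "overtakes A B m" "(A, B) \<in> ?Q" using ovQ by auto
    from overtakes_switch(2) [OF this(1) A'B'] switch_set_pairs(2) [OF this(2) this(1)]
    show "switch p \<in> ?P"
      using assms by (auto simp: AB A'B')
  qed
qed

text \<open>A pair amounts to the choice of \<open>A\<close>, of \<open>A - B\<close> inside \<open>A\<close>, and of \<open>B - A\<close> outside.\<close>

lemma card_set_pairs:
  "card (set_pairs m c k j) = (m choose (c + k)) * ((c + k) choose k) * ((m - (c + k)) choose j)"
proof -
  let ?f = "\<lambda>(A, K, J). (A, (A - K) \<union> J)"
  let ?As = "{A. A \<subseteq> {1..m} \<and> card A = c + k}"
  let ?D = "SIGMA A : ?As. {K. K \<subseteq> A \<and> card K = k} \<times> {J. J \<subseteq> {1..m} - A \<and> card J = j}"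
  have fin: "finite A" if "A \<subseteq> {1..m}" for A using that by (rule finite_subset) simp
  have "bij_betw ?f ?D (set_pairs m c k j)"
  proof (rule bij_betw_byWitness [where f' = "\<lambda>(A, B). (A, A - B, B - A)"])
    show "\<forall>x\<in>?D. (\<lambda>(A, B). (A, A - B, B - A)) (?f x) = x" by auto
    show "\<forall>x\<in>set_pairs m c k j. ?f ((\<lambda>(A, B). (A, A - B, B - A)) x) = x" by auto
    show "?f ` ?D \<subseteq> set_pairs m c k j"
    proof (rule image_subsetI)
      fix x assume "x \<in> ?D"
      then obtain A K J where x: "x = (A, K, J)"
        and *: "A \<subseteq> {1..m}" "card A = c + k" "K \<subseteq> A" "card K = k" "J \<subseteq> {1..m} - A" "card J = j"
        by auto
      have "A \<inter> (A - K \<union> J) = A - K" "A - (A - K \<union> J) = K" "(A - K \<union> J) - A = J"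
        using * by auto
      moreover have "card (A - K) = c"
        using * fin [of A] by (simp add: card_Diff_subset finite_subset)
      ultimately show "?f x \<in> set_pairs m c k j"
        using * by (auto simp: x set_pairs_def)
    qed
    show "(\<lambda>(A, B). (A, A - B, B - A)) ` set_pairs m c k j \<subseteq> ?D"
    proof (rule image_subsetI)
      fix x assume "x \<in> set_pairs m c k j"
      moreover obtain A B where x: "x = (A, B)" by fastforce
      ultimately have *: "(A, B) \<in> set_pairs m c k j" by simp
      then have "card A = c + k"
        using fin [of A] card_Int_Diff [of A B] by (auto simp: set_pairs_def)
      then show "(\<lambda>(A, B). (A, A - B, B - A)) x \<in> ?D"
        using * by (auto simp: x set_pairs_def)
    qed
  qed
  then have "card (set_pairs m c k j) = card ?D" by (simp add: bij_betw_same_card)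
  also have "\<dots> = (\<Sum>A\<in>?As. ((c + k) choose k) * ((m - (c + k)) choose j))"
  proof (subst card_SigmaI)
    show "finite ?As" by simp
    show "\<forall>A\<in>?As. finite ({K. K \<subseteq> A \<and> card K = k} \<times> {J. J \<subseteq> {1..m} - A \<and> card J = j})"
      using fin by auto
    show "(\<Sum>A\<in>?As. card ({K. K \<subseteq> A \<and> card K = k} \<times> {J. J \<subseteq> {1..m} - A \<and> card J = j})) =
      (\<Sum>A\<in>?As. ((c + k) choose k) * ((m - (c + k)) choose j))"
      using fin by (intro sum.cong refl) (auto simp: card_cartesian_product n_subsets card_Diff_subset)
  qed
  also have "\<dots> = (m choose (c + k)) * ((c + k) choose k) * ((m - (c + k)) choose j)"
    by (simp add: n_subsets)
  finally show ?thesis .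
qed

text \<open>
  Both cardinalities are multinomial coefficients of \<open>m\<close>, for the parts \<open>A \<inter> B\<close>, \<open>A - B\<close>,
  \<open>B - A\<close> and the rest; only the factorials of the middle two parts differ. If \<open>m\<close> is too small
  for the parts, both are zero.
\<close>

lemma card_set_pairs_shift:
  assumes "1 \<le> k"
  shows "(j + 1) * card (set_pairs m c (Suc j) (k - 1)) = k * card (set_pairs m c k j)"
proof (cases "c + k + j \<le> m")
  case True
  have multinomial: "card (set_pairs m c a b) * (fact c * fact a * fact b * fact (m - (c + a + b))) = fact m"
    if "c + a + b \<le> m" for a b
  proof -
    have *: "fact (c + a) * fact (m - (c + a)) * (m choose (c + a)) = (fact m :: nat)"
      "fact a * fact c * ((c + a) choose a) = (fact (c + a) :: nat)"
      "fact b * fact (m - (c + a + b)) * ((m - (c + a)) choose b) = (fact (m - (c + a)) :: nat)"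
      using binomial_fact_lemma [of "c + a" m] binomial_fact_lemma [of a "c + a"]
        binomial_fact_lemma [of b "m - (c + a)"] that by simp_all
    have "card (set_pairs m c a b) * (fact c * fact a * fact b * fact (m - (c + a + b))) =
        (fact a * fact c * ((c + a) choose a)) *
        (fact b * fact (m - (c + a + b)) * ((m - (c + a)) choose b)) * (m choose (c + a))"
      unfolding card_set_pairs by (simp only: ac_simps)
    then show ?thesis by (simp only: *)
  qed
  obtain l where l: "k = Suc l" using assms by (cases k) auto
  let ?F = "fact c * fact l * fact j * fact (m - (c + k + j)) :: nat"
  have "(j + 1) * card (set_pairs m c (Suc j) (k - 1)) * ?F = fact m"
    using multinomial [of "Suc j" l] True by (simp add: l algebra_simps)
  moreover have "k * card (set_pairs m c k j) * ?F = fact m"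
    using multinomial [of k j] True by (simp add: l algebra_simps)
  ultimately show ?thesis
    by (metis fact_nonzero mult_cancel2 mult_eq_0_iff)
next
  case False
  have "card (set_pairs m c a b) = 0" if "m < c + a + b" for a b
    using that by (cases "c + a \<le> m") (auto simp: card_set_pairs)
  from this [of k j] this [of "Suc j" "k - 1"] show ?thesis
    using False assms by simp
qed

section \<open>The number of incomparable pairs\<close>

lemma card_eq_sum_card_fibres:
  assumes "finite X" "finite T" "f ` X \<subseteq> T"
  shows "card X = (\<Sum>t\<in>T. card {x \<in> X. f x = t})"
  using sum.group [OF assms, of "\<lambda>_. 1::nat"] by simp

definition column_sets :: "nat \<Rightarrow> nat \<Rightarrow> nat set set" where
  "column_sets n m = {A. A \<subseteq> {1..m} \<and> A \<noteq> {} \<and> card A \<le> n}"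

text \<open>
  By \<open>col_le_iff_card\<close>, neither of two columns lies below the other iff each of them gets ahead
  of the other one somewhere.
\<close>

definition incomparable_pairs :: "nat \<Rightarrow> nat \<Rightarrow> (nat set \<times> nat set) set" where
  "incomparable_pairs n m = {(A, B) \<in> column_sets n m \<times> column_sets n m.
     (\<exists>t. overtakes A B t) \<and> (\<exists>t. overtakes B A t)}"

definition overtaking_pairs :: "nat \<Rightarrow> nat \<Rightarrow> (nat set \<times> nat set) set" where
  "overtaking_pairs n m = {(A, B) \<in> column_sets n m \<times> column_sets n m.
     card A \<le> card B \<and> (\<exists>t. overtakes A B t)}"

definition equal_height_pairs :: "nat \<Rightarrow> nat \<Rightarrow> (nat set \<times> nat set) set" where
  "equal_height_pairs n m = {(A, B) \<in> column_sets n m \<times> column_sets n m. card A = card B \<and> A \<noteq> B}"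

lemma finite_column_sets: "finite (column_sets n m)"
  by (rule finite_subset [of _ "Pow {1..m}"]) (auto simp: column_sets_def)

text \<open>A set is determined by the function that counts its elements up to \<open>t\<close>.\<close>

lemma overtakes_if_neq:
  assumes "A \<noteq> B"
  shows "(\<exists>t. overtakes A B t) \<or> (\<exists>t. overtakes B A t)"
proof (rule ccontr)
  assume *: "\<not> ?thesis"
  then have eq: "card (A \<inter> {..t}) = card (B \<inter> {..t})" for t
    by (meson overtakes_def linorder_neqE_nat)
  have "t \<in> A \<longleftrightarrow> t \<in> B" for t
  proof (induction t rule: less_induct)
    case (less t)
    then have low: "A \<inter> {..<t} = B \<inter> {..<t}" by auto
    have split: "card (X \<inter> {..t}) = card (X \<inter> {..<t}) + (if t \<in> X then 1 else 0)" for X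
    proof -
      have "X \<inter> {..t} = (if t \<in> X then insert t (X \<inter> {..<t}) else X \<inter> {..<t})"
        by (auto simp: le_less)
      then show ?thesis by simp
    qed
    show ?case using eq [of t] low by (auto simp: split split: if_splits)
  qed
  with assms show False by blast
qed

text \<open>
  Let \<open>O\<close> be the set \<open>overtaking_pairs n m\<close> and \<open>O'\<close> the set of its pairs in reverse order. A
  smaller set is always overtaken by a larger one, and of two distinct sets one overtakes the other.
  Hence \<open>O \<union> O'\<close> is the union of the incomparable
  pairs and the pairs of equal height, and \<open>O \<inter> O'\<close> is the intersection of the same two sets.
  The claim compares the inclusion-exclusion formulas of the two unions.
\<close>

lemma card_incomparable_pairs:
  "card (incomparable_pairs n m) + card (equal_height_pairs n m) = 2 * card (overtaking_pairs n m)"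
proof -
  let ?C = "column_sets n m"
  let ?I = "incomparable_pairs n m" and ?E = "equal_height_pairs n m" and ?O = "overtaking_pairs n m"
  let ?O' = "prod.swap ` ?O"
  have sub: "?I \<subseteq> ?C \<times> ?C" "?E \<subseteq> ?C \<times> ?C" "?O \<subseteq> ?C \<times> ?C"
    by (auto simp: incomparable_pairs_def equal_height_pairs_def overtaking_pairs_def)
  then have fin: "finite ?I" "finite ?E" "finite ?O"
    using finite_column_sets by (meson finite_SigmaI finite_subset)+
  have taller: "\<exists>t. overtakes B A t" if "A \<in> ?C" "B \<in> ?C" "card A < card B" for A B
  proof -
    have "A \<inter> {..m} = A" "B \<inter> {..m} = B" using that by (auto simp: column_sets_def)
    then show ?thesis using that by (auto simp: overtakes_def intro!: exI [of _ m])
  qed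
  have irrefl: "\<not> overtakes A A t" for A t by (simp add: overtakes_def)
  have O': "(A, B) \<in> ?O' \<longleftrightarrow> (B, A) \<in> ?O" for A B by force
  have "(A, B) \<in> ?O \<union> ?O' \<longleftrightarrow> (A, B) \<in> ?I \<union> ?E" for A B
  proof (cases "A \<in> ?C \<and> B \<in> ?C")
    case True
    then show ?thesis
      using taller [of A B] taller [of B A] irrefl overtakes_if_neq [of A B]
      unfolding Un_iff O'
      by (cases "card A" "card B" rule: linorder_cases)
        (auto simp: incomparable_pairs_def equal_height_pairs_def overtaking_pairs_def)
  qed (use sub in \<open>auto simp: O'\<close>)
  then have Un: "?O \<union> ?O' = ?I \<union> ?E" by (simp only: set_eq_iff split_paired_All) simp
  have "(A, B) \<in> ?O \<inter> ?O' \<longleftrightarrow> (A, B) \<in> ?I \<inter> ?E" for A B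
    unfolding Int_iff O' using irrefl
    by (auto simp: incomparable_pairs_def equal_height_pairs_def overtaking_pairs_def)
  then have Int: "?O \<inter> ?O' = ?I \<inter> ?E" by (simp only: set_eq_iff split_paired_All) simp
  have "card ?I + card ?E = card ?O + card ?O'"
    using card_Un_Int [OF fin(1,2)] card_Un_Int [OF fin(3), of ?O'] fin(3) by (simp add: Un Int)
  also have "card ?O' = card ?O" by (intro card_image inj_onI) auto
  finally show ?thesis by simp
qed

lemma card_diff_bounds:
  assumes "A \<subseteq> {1..m}" "B \<subseteq> {1..m}"
  shows "card (A - B) \<le> card A" "card (B - A) \<le> m - card A"
    "card A = card (A \<inter> B) + card (A - B)" "card B = card (A \<inter> B) + card (B - A)"
proof -
  have fin: "finite A" "finite B" using assms by (auto intro: finite_subset)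
  show "card (A - B) \<le> card A" using fin by (intro card_mono) auto
  have "card (B - A) \<le> card ({1..m} - A)" using assms by (intro card_mono) auto
  then show "card (B - A) \<le> m - card A" using assms fin by (simp add: card_Diff_subset)
  show "card A = card (A \<inter> B) + card (A - B)" "card B = card (A \<inter> B) + card (B - A)"
    using fin by (metis card_Int_Diff Int_commute)+
qed

text \<open>
  The pairs are sorted by \<open>i = card A\<close>, \<open>k = card (A - B)\<close> and \<open>j = card (B - A)\<close>. The range
  of \<open>j\<close> expresses \<open>card A \<le> card B \<le> n\<close> since \<open>card B = i - k + j\<close>, and \<open>k = 0\<close> cannot occur
  because a subset never overtakes.
\<close>

lemma card_overtaking_pairs_eq:
  "rat_of_nat (card (overtaking_pairs n m)) =
    (\<Sum>i=1..n. \<Sum>k=1..min i (m - i). \<Sum>j=k..min (n + k - i) (m - i).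
      of_nat (m choose i) * of_nat (i choose k) * (of_nat k / of_nat (j + 1) * of_nat ((m - i) choose j)))"
proof -
  let ?T = "SIGMA i:{1..n}. SIGMA k:{1..min i (m - i)}. {k..min (n + k - i) (m - i)}"
  let ?f = "\<lambda>(A::nat set, B). (card A, card (A - B), card (B - A))"
  have "overtaking_pairs n m \<subseteq> column_sets n m \<times> column_sets n m"
    by (auto simp: overtaking_pairs_def)
  then have fin: "finite (overtaking_pairs n m)"
    using finite_column_sets by (meson finite_SigmaI finite_subset)
  have sub: "?f ` overtaking_pairs n m \<subseteq> ?T"
  proof (rule image_subsetI)
    fix p assume "p \<in> overtaking_pairs n m"
    moreover obtain A B where p: "p = (A, B)" by fastforce
    ultimately have sub: "A \<subseteq> {1..m}" "B \<subseteq> {1..m}" and A: "A \<noteq> {}" "card A \<le> card B" "card B \<le> n"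
      and ov: "\<exists>t. overtakes A B t"
      by (auto simp: overtaking_pairs_def column_sets_def)
    then have "finite A" by (auto intro: finite_subset)
    then have "1 \<le> card A" using A(1) by (simp add: Suc_le_eq card_gt_0_iff)
    moreover have "0 < card (A - B)"
      using ov sub switch_set_pairs(1) [of A B m "card (A \<inter> B)" "card (A - B)" "card (B - A)"]
      by (auto simp: set_pairs_def)
    ultimately show "?f p \<in> ?T"
      using card_diff_bounds [OF sub] A by (auto simp: p)
  qed
  have nested: "sum h ?T = (\<Sum>i=1..n. \<Sum>k=1..min i (m - i). \<Sum>j=k..min (n + k - i) (m - i). h (i, k, j))"
    for h :: "nat \<times> nat \<times> nat \<Rightarrow> nat"
    by (simp add: sum.Sigma case_prod_beta)
  have "card (overtaking_pairs n m) = (\<Sum>t\<in>?T. card {p \<in> overtaking_pairs n m. ?f p = t})"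
    by (intro card_eq_sum_card_fibres fin sub) auto
  also have "\<dots> = (\<Sum>i=1..n. \<Sum>k=1..min i (m - i). \<Sum>j=k..min (n + k - i) (m - i).
      card {p \<in> overtaking_pairs n m. ?f p = (i, k, j)})"
    by (rule nested)
  finally have sum: "rat_of_nat (card (overtaking_pairs n m)) =
    (\<Sum>i=1..n. \<Sum>k=1..min i (m - i). \<Sum>j=k..min (n + k - i) (m - i).
      of_nat (card {p \<in> overtaking_pairs n m. ?f p = (i, k, j)}))"
    by simp
  show ?thesis unfolding sum
  proof (intro sum.cong refl)
    fix i k j assume i: "i \<in> {1..n}" and k: "k \<in> {1..min i (m - i)}"
      and j: "j \<in> {k..min (n + k - i) (m - i)}"
    have "{p \<in> overtaking_pairs n m. ?f p = (i, k, j)} =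
        {(A, B) \<in> set_pairs m (i - k) k j. \<exists>t. overtakes A B t}" (is "?l = ?r")
    proof (intro equalityI subsetI)
      fix p assume "p \<in> ?l"
      then show "p \<in> ?r"
        using card_diff_bounds [of "fst p" m "snd p"]
        by (auto simp: overtaking_pairs_def column_sets_def set_pairs_def)
    next
      fix p assume "p \<in> ?r"
      moreover obtain A B where p: "p = (A, B)" by fastforce
      ultimately have sub: "A \<subseteq> {1..m}" "B \<subseteq> {1..m}" and ov: "\<exists>t. overtakes A B t"
        and cards: "card (A \<inter> B) = i - k" "card (A - B) = k" "card (B - A) = j"
        by (auto simp: set_pairs_def)
      have "card A = i" "card B = i - k + j"
        using cards k card_diff_bounds [OF sub] by auto
      moreover from this have "A \<noteq> {}" "B \<noteq> {}" using i j k by auto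
      ultimately show "p \<in> ?l"
        using sub ov cards i j k
        by (auto simp: p overtaking_pairs_def column_sets_def)
    qed
    then have "card {p \<in> overtaking_pairs n m. ?f p = (i, k, j)} = card (set_pairs m (i - k) (Suc j) (k - 1))"
      using card_overtaking_set_pairs [of k j m "i - k"] j k by simp
    moreover have "(rat_of_nat j + 1) * of_nat (card (set_pairs m (i - k) (Suc j) (k - 1))) =
        of_nat k * of_nat (card (set_pairs m (i - k) k j))"
      using arg_cong [OF card_set_pairs_shift [of k j m "i - k"], of rat_of_nat] k
      by (simp add: algebra_simps)
    moreover have "card (set_pairs m (i - k) k j) = (m choose i) * (i choose k) * ((m - i) choose j)"
      using k by (simp add: card_set_pairs)
    moreover have "rat_of_nat j + 1 \<noteq> 0"
      by (metis of_nat_Suc of_nat_eq_0_iff add.commute nat.distinct(1))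
    ultimately show "rat_of_nat (card {p \<in> overtaking_pairs n m. ?f p = (i, k, j)}) =
        of_nat (m choose i) * of_nat (i choose k) * (of_nat k / of_nat (j + 1) * of_nat ((m - i) choose j))"
      by (simp add: field_simps)
  qed
qed

lemma card_equal_height_pairs:
  "card (equal_height_pairs n m) =
    (\<Sum>i=1..n. \<Sum>k=1..min i (m - i). (m choose i) * (i choose k) * ((m - i) choose k))"
proof -
  let ?T = "SIGMA i:{1..n}. {1..min i (m - i)}"
  let ?f = "\<lambda>(A::nat set, B). (card A, card (A - B))"
  have "equal_height_pairs n m \<subseteq> column_sets n m \<times> column_sets n m"
    by (auto simp: equal_height_pairs_def)
  then have fin_pairs: "finite (equal_height_pairs n m)"
    using finite_column_sets by (meson finite_SigmaI finite_subset)
  have sub: "?f ` equal_height_pairs n m \<subseteq> ?T"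
  proof (rule image_subsetI)
    fix p assume "p \<in> equal_height_pairs n m"
    moreover obtain A B where p: "p = (A, B)" by fastforce
    ultimately have sub: "A \<subseteq> {1..m}" "B \<subseteq> {1..m}" and A: "A \<noteq> {}" "card A = card B" "card A \<le> n" "A \<noteq> B"
      by (auto simp: equal_height_pairs_def column_sets_def)
    then have fin: "finite A" "finite B" by (auto intro: finite_subset)
    then have "1 \<le> card A" using A(1) by (simp add: Suc_le_eq card_gt_0_iff)
    moreover have "\<not> A \<subseteq> B" using A card_subset_eq [OF fin(2), of A] by blast
    then have "0 < card (A - B)" using fin by (simp add: card_gt_0_iff)
    ultimately show "?f p \<in> ?T"
      using card_diff_bounds [OF sub] A by (auto simp: p)
  qed
  have nested: "sum h ?T = (\<Sum>i=1..n. \<Sum>k=1..min i (m - i). h (i, k))" for h :: "nat \<times> nat \<Rightarrow> nat"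
    by (simp add: sum.Sigma case_prod_beta)
  have "card (equal_height_pairs n m) = (\<Sum>t\<in>?T. card {p \<in> equal_height_pairs n m. ?f p = t})"
    by (intro card_eq_sum_card_fibres fin_pairs sub) auto
  also have "\<dots> = (\<Sum>i=1..n. \<Sum>k=1..min i (m - i). card {p \<in> equal_height_pairs n m. ?f p = (i, k)})"
    by (rule nested)
  also have "\<dots> = (\<Sum>i=1..n. \<Sum>k=1..min i (m - i). (m choose i) * (i choose k) * ((m - i) choose k))"
  proof (intro sum.cong refl)
    fix i k assume i: "i \<in> {1..n}" and k: "k \<in> {1..min i (m - i)}"
    have "{p \<in> equal_height_pairs n m. ?f p = (i, k)} = set_pairs m (i - k) k k" (is "?l = ?r")
    proof (intro equalityI subsetI)
      fix p assume "p \<in> ?l"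
      then show "p \<in> ?r"
        using card_diff_bounds [of "fst p" m "snd p"]
        by (auto simp: equal_height_pairs_def column_sets_def set_pairs_def)
    next
      fix p assume "p \<in> ?r"
      moreover obtain A B where p: "p = (A, B)" by fastforce
      ultimately have sub: "A \<subseteq> {1..m}" "B \<subseteq> {1..m}"
        and cards: "card (A \<inter> B) = i - k" "card (A - B) = k" "card (B - A) = k"
        by (auto simp: set_pairs_def)
      have "card A = i" "card B = i"
        using cards k card_diff_bounds [OF sub] by auto
      moreover from this have "A \<noteq> {}" "B \<noteq> {}" using i by auto
      moreover have "A \<noteq> B" using cards(2) k by auto
      ultimately show "p \<in> ?l"
        using sub cards i by (auto simp: p equal_height_pairs_def column_sets_def)
    qed
    then show "card {p \<in> equal_height_pairs n m. ?f p = (i, k)} = (m choose i) * (i choose k) * ((m - i) choose k)"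
      using k by (simp add: card_set_pairs)
  qed
  finally show ?thesis .
qed

lemma half_card_incomparable_pairs:
  "rat_of_nat (card (incomparable_pairs n m)) / 2 =
    (\<Sum>i=1..n. of_nat (m choose i) *
      (\<Sum>k=1..min i (m - i). of_nat (i choose k) *
        (- (1/2) * of_nat ((m - i) choose k) +
         (\<Sum>j=k..min (n + k - i) (m - i).
            of_nat k / of_nat (j + 1) * of_nat ((m - i) choose j)))))"
proof -
  have "rat_of_nat (card (incomparable_pairs n m)) / 2 =
      of_nat (card (overtaking_pairs n m)) - of_nat (card (equal_height_pairs n m)) / 2"
    using arg_cong [OF card_incomparable_pairs [of n m], of rat_of_nat] by simp
  also have "\<dots> = (\<Sum>i=1..n. \<Sum>k=1..min i (m - i).
      (\<Sum>j=k..min (n + k - i) (m - i).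
        of_nat (m choose i) * of_nat (i choose k) * (of_nat k / of_nat (j + 1) * of_nat ((m - i) choose j))) -
      of_nat (m choose i) * of_nat (i choose k) * of_nat ((m - i) choose k) / 2)"
    by (simp add: card_overtaking_pairs_eq card_equal_height_pairs sum_subtractf sum_divide_distrib)
  also have "\<dots> = (\<Sum>i=1..n. of_nat (m choose i) *
      (\<Sum>k=1..min i (m - i). of_nat (i choose k) *
        (- (1/2) * of_nat ((m - i) choose k) +
         (\<Sum>j=k..min (n + k - i) (m - i).
            of_nat k / of_nat (j + 1) * of_nat ((m - i) choose j)))))"
    unfolding sum_distrib_left
    by (intro sum.cong refl) (simp only: sum_distrib_left [symmetric], simp add: algebra_simps)
  finally show ?thesis .
qed

section \<open>The straightening relations generate minimally\<close>

definition incomparable_columns :: "nat \<Rightarrow> nat \<Rightarrow> (nat list \<times> nat list) set" where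
  "incomparable_columns n m =
     {(xs, ys) \<in> columns n m \<times> columns n m. \<not> col_le xs ys \<and> \<not> col_le ys xs}"

text \<open>
  As in a straightening law, the product of two incomparable columns is rewritten as the standard
  monomial of their meet and join.
\<close>

definition straightening :: "nat list \<times> nat list \<Rightarrow> (tableau, 'k::comm_ring_1) mpolynomial" where
  "straightening = (\<lambda>(xs, ys). indet (col xs) * indet (col ys) -
     indet (col (col_meet xs ys)) * indet (col (col_join xs ys)))"

definition col_monomial :: "nat list \<times> nat list \<Rightarrow> tableau \<Rightarrow>\<^sub>0 nat" where
  "col_monomial = (\<lambda>(xs, ys). Poly_Mapping.single (col xs) 1 + Poly_Mapping.single (col ys) 1)"

lemma col_monomial_eq_iff:
  "col_monomial (xs, ys) = col_monomial (us, vs) \<longleftrightarrow> (xs, ys) = (us, vs) \<or> (xs, ys) = (vs, us)"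
proof
  assume "col_monomial (xs, ys) = col_monomial (us, vs)"
  then have *: "Poly_Mapping.single (col xs) 1 + Poly_Mapping.single (col ys) 1 =
      Poly_Mapping.single (col us) 1 + Poly_Mapping.single (col vs) (1::nat)"
    by (simp add: col_monomial_def)
  have single: "s = t" if "Poly_Mapping.single s (1::nat) = Poly_Mapping.single t 1" for s t :: tableau
  proof -
    have "Poly_Mapping.keys (Poly_Mapping.single s (1::nat)) = Poly_Mapping.keys (Poly_Mapping.single t (1::nat))"
      by (simp only: that)
    then show ?thesis by simp
  qed
  show "(xs, ys) = (us, vs) \<or> (xs, ys) = (vs, us)"
    using single_add_eq_single_addD [OF *] single unfolding inj_col by (metis inj_col)
qed (auto simp: col_monomial_def add.commute)

lemma lookup_straightening:
  "Poly_Mapping.lookup (straightening p :: (tableau, 'k::comm_ring_1) mpolynomial) e =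
    (1 when col_monomial p = e) - (1 when col_monomial (case_prod col_meet p, case_prod col_join p) = e)"
  by (cases p)
    (simp add: straightening_def col_monomial_def indet_mult_indet lookup_minus lookup_single)

lemma straightening_swap: "straightening (xs, ys) = straightening (ys, xs)"
  by (simp add: straightening_def col_meet_commute [of xs] col_join_commute [of xs] mult.commute)

lemma straightening_col_le: "col_le xs ys \<Longrightarrow> straightening (xs, ys) = 0"
  by (simp add: straightening_def col_meet_eq_iff [THEN iffD2] col_join_eq_iff [THEN iffD2])

text \<open>
  The second term of a straightening relation is a product of two comparable columns, so it is not
  the monomial of an incomparable pair.
\<close>

lemma lookup_straightening_incomparable:
  assumes "p \<in> incomparable_columns n m" "q \<in> incomparable_columns n m"
  shows "Poly_Mapping.lookup (straightening p :: (tableau, 'k::comm_ring_1) mpolynomial) (col_monomial q) =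
    (1 when col_monomial p = col_monomial q)"
proof -
  obtain us vs where q: "q = (us, vs)" by fastforce
  have "col_monomial (col_meet xs ys, col_join xs ys) \<noteq> col_monomial q" for xs ys
    using assms(2) col_le_col_meet_col_join [of xs ys]
    by (auto simp: q col_monomial_eq_iff incomparable_columns_def)
  then show ?thesis by (cases p) (simp add: lookup_straightening)
qed

lemma straightening_eq_iff:
  assumes p: "p \<in> incomparable_columns n m" and q: "q \<in> incomparable_columns n m"
  shows "(straightening p :: (tableau, 'k::comm_ring_1) mpolynomial) = straightening q \<longleftrightarrow>
    p = q \<or> p = prod.swap q"
proof
  assume "(straightening p :: (tableau, 'k) mpolynomial) = straightening q"
  then have "((1::'k) when col_monomial p = col_monomial q) = 1"
    using lookup_straightening_incomparable [OF p q, where 'k = 'k]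
      lookup_straightening_incomparable [OF q q, where 'k = 'k] by simp
  then have "col_monomial p = col_monomial q" by (auto simp: when_def split: if_splits)
  then show "p = q \<or> p = prod.swap q"
    by (cases p; cases q) (auto simp: col_monomial_eq_iff)
next
  assume "p = q \<or> p = prod.swap q"
  then show "(straightening p :: (tableau, 'k) mpolynomial) = straightening q"
    by (cases q) (auto intro: straightening_swap)
qed

lemma vanishes_on_proper_divisors_straightening:
  "vanishes_on_proper_divisors (range col_monomial) (straightening p)"
  unfolding vanishes_on_proper_divisors_def
proof (intro allI impI)
  fix a b assume ab: "a + b \<in> range col_monomial" "a \<noteq> (0 :: tableau \<Rightarrow>\<^sub>0 nat)"
  have "b \<noteq> col_monomial q" for q
  proof
    assume "b = col_monomial q"
    then have "a = 0"
      using ab(1) add_quadratic_eq_quadraticD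
      by (auto simp: col_monomial_def split: prod.splits)
    with ab(2) show False by simp
  qed
  then have "col_monomial q \<noteq> b" for q by metis
  then show "Poly_Mapping.lookup (straightening p) b = 0"
    by (simp add: lookup_straightening)
qed

lemma col_meet_in_columns:
  assumes "xs \<in> columns n m" "ys \<in> columns n m"
  shows "col_meet xs ys \<in> columns n m"
  using assms set_col_meet [of xs ys] length_col_meet [of xs ys]
  by (auto simp: columns_def sorted_col_meet max_def split: if_splits)

lemma col_join_in_columns:
  assumes "xs \<in> columns n m" "ys \<in> columns n m"
  shows "col_join xs ys \<in> columns n m"
proof -
  have "set (col_join xs ys) \<subseteq> set xs \<union> set ys"
    by (auto simp: max_def dest!: set_col_join)
  then have "set (col_join xs ys) \<subseteq> {1..m}"
    using assms unfolding columns_def by blast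
  moreover have "col_join xs ys \<noteq> []" "length (col_join xs ys) \<le> n"
    using assms length_col_join [of xs ys] by (auto simp: columns_def min_def split: if_splits)
  ultimately show ?thesis using assms by (simp add: columns_def sorted_col_join)
qed

lemma finite_columns: "finite (columns n m)"
  by (rule finite_subset [OF _ finite_lists_length_le [of "{1..m}" n]]) (auto simp: columns_def)

lemma finite_incomparable_columns: "finite (incomparable_columns n m)"
  by (rule finite_subset [OF _ finite_cartesian_product [OF finite_columns [of n m] finite_columns [of n m]]])
    (auto simp: incomparable_columns_def)

lemma straightening_in_P_gens:
  assumes "p \<in> incomparable_columns n m"
  shows "straightening p \<in> P_gens n m"
proof -
  obtain xs ys where p: "p = (xs, ys)" by fastforce
  then have in_columns: "xs \<in> columns n m" "ys \<in> columns n m"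
    and incomp: "\<not> col_le xs ys" "\<not> col_le ys xs"
    using assms by (auto simp: incomparable_columns_def)
  have "distinct [xs, ys, col_meet xs ys, col_join xs ys]"
    using incomp col_le_refl [of xs] col_meet_eq_iff [of xs ys] col_meet_eq_iff [of ys xs]
      col_join_eq_iff [of xs ys] col_join_eq_iff [of ys xs] col_meet_eq_col_joinD [of xs ys]
    by (auto simp: col_meet_commute [of ys] col_join_commute [of ys])
  then have "distinct [col xs, col ys, col (col_meet xs ys), col (col_join xs ys)]"
    by (simp add: inj_col)
  moreover have "{col xs, col ys, col (col_meet xs ys), col (col_join xs ys)} \<subseteq> G n m"
    using in_columns col_meet_in_columns [OF in_columns] col_join_in_columns [OF in_columns]
    by (auto simp: G_eq)
  ultimately show ?thesis
    using star_col [of xs ys] unfolding P_gens_def mem_Collect_eq p straightening_def prod.case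
    by (intro exI conjI) (rule refl | assumption)+
qed

lemma P_gens_subset_carrier: "P_gens n m \<subseteq> carrier (poly_ring (G n m))"
proof
  fix p :: "(tableau, 'k::comm_ring_1) mpolynomial" assume "p \<in> P_gens n m"
  then obtain T1 T2 T3 T4 where p: "p = indet T1 * indet T2 - indet T3 * indet T4"
    and T: "{T1, T2, T3, T4} \<subseteq> G n m"
    unfolding P_gens_def by blast
  have "ideal (carrier (poly_ring (G n m) :: (tableau, 'k) mpolynomial ring)) (poly_ring (G n m))"
    by (intro ring.oneideal cring.axioms(1) poly_ring_cring)
  moreover have "indet T * indet T' \<in> carrier (poly_ring (G n m) :: (tableau, 'k) mpolynomial ring)"
    if "T \<in> G n m" "T' \<in> G n m" for T T'
    using that keys_add [of "Poly_Mapping.single T (1::nat)" "Poly_Mapping.single T' 1"]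
    by (auto simp: indet_mult_indet indets_def split: if_splits)
  ultimately show "p \<in> carrier (poly_ring (G n m))"
    unfolding p using T by (intro ideal_minus_closed) auto
qed

text \<open>
  If \<open>T1 \<star> T2 = T3 \<star> T4\<close>, both products straighten to the same monomial, which cancels in the
  difference of the two relations. Conversely, the relation of an incomparable pair is one of the
  generators, as its four columns are distinct.
\<close>

lemma P_ideal_eq:
  "P_ideal n m = genideal (poly_ring (G n m)) (straightening ` incomparable_columns n m)"
    (is "_ = genideal ?R ?S")
proof -
  interpret cring ?R by (rule poly_ring_cring)
  have S: "?S \<subseteq> P_gens n m" using straightening_in_P_gens by blast
  have I: "ideal (genideal ?R ?S) ?R"
    using S P_gens_subset_carrier by (intro genideal_ideal) blast
  have straight: "straightening (xs, ys) \<in> genideal ?R ?S"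
    if "xs \<in> columns n m" "ys \<in> columns n m" for xs ys
  proof (cases "col_le xs ys \<or> col_le ys xs")
    case True
    then have "straightening (xs, ys) = (0 :: (tableau, 'a) mpolynomial)"
      by (metis straightening_col_le straightening_swap)
    then show ?thesis
      using additive_subgroup.zero_closed [OF ideal.axioms(1) [OF I]] by simp
  next
    case False
    then have "straightening (xs, ys) \<in> ?S"
      using that by (auto simp: incomparable_columns_def)
    then show ?thesis
      using genideal_self [of ?S] S P_gens_subset_carrier by blast
  qed
  have "P_gens n m \<subseteq> genideal ?R ?S"
  proof
    fix p :: "(tableau, 'a) mpolynomial" assume "p \<in> P_gens n m"
    then obtain T1 T2 T3 T4 where p: "p = indet T1 * indet T2 - indet T3 * indet T4"
      and T: "{T1, T2, T3, T4} \<subseteq> G n m" and star: "T1 \<star> T2 = T3 \<star> T4"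
      unfolding P_gens_def by blast
    have "\<exists>zs\<in>columns n m. T' = col zs" if "T' \<in> {T1, T2, T3, T4}" for T'
      using T that unfolding G_eq by blast
    then obtain xs ys us vs where cols: "T1 = col xs" "T2 = col ys" "T3 = col us" "T4 = col vs"
      and in_columns: "xs \<in> columns n m" "ys \<in> columns n m" "us \<in> columns n m" "vs \<in> columns n m"
      by (metis insertCI)
    have "p = straightening (xs, ys) - straightening (us, vs)"
      using star by (simp add: p cols star_col_eq_iff straightening_def)
    then show "p \<in> genideal ?R ?S"
      using in_columns by (simp add: ideal_minus_closed [OF I] straight)
  qed
  then have "genideal ?R (P_gens n m) \<subseteq> genideal ?R ?S"
    by (rule genideal_minimal [OF I])
  moreover have "genideal ?R ?S \<subseteq> genideal ?R (P_gens n m)"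
    using S genideal_self [OF P_gens_subset_carrier]
    by (intro genideal_minimal genideal_ideal P_gens_subset_carrier) blast
  ultimately show ?thesis unfolding P_ideal_def by (rule equalityI)
qed

text \<open>
  A relation and the monomial of its pair determine each other up to the order of the pair, so the
  choice of one of the two orders is harmless.
\<close>

lemma varsigma_P_eq:
  "varsigma_P TYPE('k::field) n m =
    card (straightening ` incomparable_columns n m :: (tableau, 'k) mpolynomial set)"
  unfolding varsigma_P_def P_ideal_eq
proof (rule min_num_gens_eq_card)
  let ?I = "incomparable_columns n m"
  let ?S = "straightening ` ?I :: (tableau, 'k) mpolynomial set"
  let ?pick = "inv_into ?I straightening :: (tableau, 'k) mpolynomial \<Rightarrow> _"
  show "finite ?S" using finite_incomparable_columns by simp
  show "?S \<subseteq> carrier (poly_ring (G n m))"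
    using straightening_in_P_gens P_gens_subset_carrier by blast
  have pick: "?pick g \<in> ?I" "straightening (?pick g) = g" if "g \<in> ?S" for g
    using that by (auto intro: inv_into_into f_inv_into_f)
  fix g assume g: "g \<in> ?S"
  show "vanishes_on_proper_divisors ((\<lambda>g. col_monomial (?pick g)) ` ?S) g"
    using g vanishes_on_proper_divisors_straightening by (fastforce simp: vanishes_on_proper_divisors_def)
  fix h assume h: "h \<in> ?S"
  have "Poly_Mapping.lookup (straightening (?pick g)) (col_monomial (?pick h)) =
      ((1::'k) when col_monomial (?pick g) = col_monomial (?pick h))"
    using pick g h by (intro lookup_straightening_incomparable) auto
  moreover have "col_monomial (?pick g) = col_monomial (?pick h) \<longleftrightarrow> g = h"
    using pick(2) [OF g] pick(2) [OF h]
    by (metis col_monomial_eq_iff straightening_swap surj_pair)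
  ultimately show "Poly_Mapping.lookup g (col_monomial (?pick h)) = (if g = h then 1 else 0)"
    using pick(2) [OF g] by (simp add: when_def)
qed

text \<open>Each relation comes from the two orders of one pair of distinct columns.\<close>

lemma card_incomparable_columns_straightening:
  "card (incomparable_columns n m) =
    2 * card (straightening ` incomparable_columns n m :: (tableau, 'k::comm_ring_1) mpolynomial set)"
proof -
  let ?I = "incomparable_columns n m"
  let ?S = "straightening ` ?I :: (tableau, 'k) mpolynomial set"
  have "card ?I = (\<Sum>g\<in>?S. card {p \<in> ?I. straightening p = g})"
    using finite_incomparable_columns by (intro card_eq_sum_card_fibres) auto
  also have "\<dots> = (\<Sum>g\<in>?S. 2)"
  proof (rule sum.cong [OF refl])
    fix g assume "g \<in> ?S"
    then obtain q where q: "q \<in> ?I" "g = straightening q" by blast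
    obtain xs ys where xs: "q = (xs, ys)" by fastforce
    have swap: "prod.swap q \<in> ?I" and neq: "q \<noteq> prod.swap q"
      using q(1) col_le_refl [of xs] by (auto simp: xs incomparable_columns_def)
    have "{p \<in> ?I. straightening p = g} = {q, prod.swap q}"
      using q swap by (auto simp: straightening_eq_iff [OF _ q(1), where 'k = 'k])
    then show "card {p \<in> ?I. straightening p = g} = 2" using neq by simp
  qed
  finally show ?thesis by simp
qed

lemma card_incomparable_columns: "card (incomparable_columns n m) = card (incomparable_pairs n m)"
proof (rule bij_betw_same_card)
  let ?f = "map_prod set set :: nat list \<times> nat list \<Rightarrow> _"
  let ?g = "map_prod sorted_list_of_set sorted_list_of_set :: nat set \<times> nat set \<Rightarrow> _"
  have set_columns: "set xs \<in> column_sets n m" "sorted_list_of_set (set xs) = xs"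
    if "xs \<in> columns n m" for xs
    using that by (auto simp: columns_def column_sets_def strict_sorted_iff distinct_card
        sorted_list_of_set_sort_remdups distinct_remdups_id sorted_sort_id)
  have list_columns: "sorted_list_of_set A \<in> columns n m" "set (sorted_list_of_set A) = A"
    if "A \<in> column_sets n m" for A
  proof -
    have "finite A" using that by (auto simp: column_sets_def intro: finite_subset)
    then show "sorted_list_of_set A \<in> columns n m" "set (sorted_list_of_set A) = A"
      using that by (auto simp: columns_def column_sets_def)
  qed
  have below: "col_le xs ys \<longleftrightarrow> \<not> (\<exists>t. overtakes (set ys) (set xs) t)"
    if "xs \<in> columns n m" "ys \<in> columns n m" for xs ys
    using that by (auto simp: columns_def col_le_iff_card overtakes_def not_less)
  show "bij_betw ?f (incomparable_columns n m) (incomparable_pairs n m)"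
  proof (rule bij_betw_byWitness [of _ ?g])
    show "\<forall>p\<in>incomparable_columns n m. ?g (?f p) = p"
      by (auto simp: incomparable_columns_def set_columns)
    show "\<forall>p\<in>incomparable_pairs n m. ?f (?g p) = p"
      by (auto simp: incomparable_pairs_def list_columns)
    show "?f ` incomparable_columns n m \<subseteq> incomparable_pairs n m"
      by (auto simp: incomparable_columns_def incomparable_pairs_def set_columns below)
    show "?g ` incomparable_pairs n m \<subseteq> incomparable_columns n m"
      by (auto simp: incomparable_columns_def incomparable_pairs_def list_columns below)
  qed
qed

theorem corollary2p27:
  fixes n m :: nat
  assumes "1 \<le> n" and "n \<le> m"
  shows "rat_of_nat (varsigma_P TYPE('k::{alg_closed_field, field_char_0}) n m) =
    (\<Sum>i=1..n. of_nat (m choose i) *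
      (\<Sum>k=1..min i (m - i). of_nat (i choose k) *
        (- (1/2) * of_nat ((m - i) choose k) +
         (\<Sum>j=k..min (n + k - i) (m - i).
            of_nat k / of_nat (j + 1) * of_nat ((m - i) choose j)))))"
proof -
  have "card (incomparable_pairs n m) = 2 * varsigma_P TYPE('k) n m"
    by (simp add: varsigma_P_eq card_incomparable_columns_straightening [where 'k = 'k]
        flip: card_incomparable_columns)
  then have "rat_of_nat (varsigma_P TYPE('k) n m) = of_nat (card (incomparable_pairs n m)) / 2"
    by simp
  then show ?thesis by (simp only: half_card_incomparable_pairs)
qed

end
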